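(* Let $K,L,Q\in\mathcal{S}_{c+}^n$, let $q\ne0$ be real, let $\varphi:(0,\infty)\to(0,\infty)$ be continuous, and let $\varphi_q(t)=\varphi(t^{1/q})$ for $t\in(0,\infty)$. If $\varphi_q$ is strictly convex or strictly concave and $$\widetilde{V}_{q,\varphi}(K,M,Q)=\widetilde{V}_{q,\varphi}(L,M,Q)$$ for all $M\in\mathcal{S}_{c+}^n$, then $K=L$.
   Context: $\mathcal{S}_{c+}^n$ is the class of star bodies in $\mathbb{R}^n$: compact sets $L$ that are star-shaped about the origin and whose radial function $\rho_L(u)=\sup\{\lambda>0:\lambda u\in L\}$, $u\in S^{n-1}$, is positive and continuous on $S^{n-1}$ (so a star body is determined by its radial function). With $du=d\mathcal{H}^{n-1}(u)$ on $S^{n-1}$, define $$\widetilde{V}_{q,\varphi}(K,L,Q)=\frac1n\int_{S^{n-1}}\varphi\!\left(\frac{\rho_L(u)}{\rho_K(u)}\right)\rho_K(u)^q\rho_Q(u)^{n-q}\,du.$$ *)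

theory Defs
  imports "HOL-Analysis.Analysis"
begin

section \<open>Hausdorff measure\<close>

text \<open>
  The \<open>k\<close>-dimensional Hausdorff measure with the usual normalization by the volume of the
  \<open>k\<close>-dimensional unit ball, so that it is the ordinary surface area on
  \<open>k\<close>-dimensional surfaces.  The case distinction on the empty set matters
  only for \<open>k = 0\<close>, where a nonempty set of diameter 0 has gauge 1 and the measure is the
  counting measure.
\<close>

definition hausdorff_gauge :: "nat \<Rightarrow> 'a::metric_space set \<Rightarrow> ennreal" where
  "hausdorff_gauge k C =
     (if C = {} then 0 else ennreal (unit_ball_vol (real k) * (diameter C / 2) ^ k))"

text \<open>Boundedness is required because \<^const>\<open>diameter\<close> is only meaningful for bounded sets.\<close>

definition hausdorff_premeasure :: "nat \<Rightarrow> real \<Rightarrow> 'a::metric_space set \<Rightarrow> ennreal" where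
  "hausdorff_premeasure k \<delta> A =
     (INF C \<in> {C :: nat \<Rightarrow> 'a set. A \<subseteq> (\<Union>i. C i) \<and> (\<forall>i. bounded (C i) \<and> diameter (C i) \<le> \<delta>)}.
        \<Sum>i. hausdorff_gauge k (C i))"

definition hausdorff_outer :: "nat \<Rightarrow> 'a::metric_space set \<Rightarrow> ennreal" where
  "hausdorff_outer k A = (SUP \<delta> \<in> {0<..}. hausdorff_premeasure k \<delta> A)"

text \<open>
  This is a metric outer measure, hence countably additive on the Borel sets by
  Caratheodory's criterion; the measure below is its restriction to the Borel sets.
\<close>

definition hausdorff_measure :: "nat \<Rightarrow> 'a::metric_space measure" where
  "hausdorff_measure k = measure_of UNIV (sets borel) (hausdorff_outer k)"


section \<open>Star bodies\<close>

text \<open>The supremum of the empty set is read as 0 (in \<^typ>\<open>real\<close> it would be unspecified).\<close>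

definition radial_function :: "'a::real_normed_vector set \<Rightarrow> 'a \<Rightarrow> real" where
  "radial_function L u =
     (if \<exists>t>0. t *\<^sub>R u \<in> L then Sup {t. t > 0 \<and> t *\<^sub>R u \<in> L} else 0)"

definition star_body :: "'a::real_normed_vector set \<Rightarrow> bool" where
  "star_body L \<longleftrightarrow>
     compact L \<and> (\<forall>x\<in>L. closed_segment 0 x \<subseteq> L) \<and>
     (\<forall>u\<in>sphere 0 1. radial_function L u > 0) \<and>
     continuous_on (sphere 0 1) (radial_function L)"


section \<open>Dual Orlicz mixed volume\<close>

definition dual_orlicz_mixed_volume ::
    "real \<Rightarrow> (real \<Rightarrow> real) \<Rightarrow> (real ^ 'n) set \<Rightarrow> (real ^ 'n) set \<Rightarrow> (real ^ 'n) set \<Rightarrow> real" where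
  "dual_orlicz_mixed_volume q \<phi> K L Q =
     1 / real CARD('n) *
     (LINT u : sphere 0 1 | hausdorff_measure (CARD('n) - 1).
        \<phi> (radial_function L u / radial_function K u)
          * radial_function K u powr q
          * radial_function Q u powr (real CARD('n) - q))"


section \<open>Strict convexity\<close>

definition strictly_convex_on :: "'a::real_vector set \<Rightarrow> ('a \<Rightarrow> real) \<Rightarrow> bool" where
  "strictly_convex_on S f \<longleftrightarrow>
     convex S \<and>
     (\<forall>x\<in>S. \<forall>y\<in>S. \<forall>t. x \<noteq> y \<and> 0 < t \<and> t < 1 \<longrightarrow>
        f ((1 - t) *\<^sub>R x + t *\<^sub>R y) < (1 - t) * f x + t * f y)"

definition strictly_concave_on :: "'a::real_vector set \<Rightarrow> ('a \<Rightarrow> real) \<Rightarrow> bool" where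
  "strictly_concave_on S f \<longleftrightarrow> strictly_convex_on S (\<lambda>x. - f x)"

end

theory Submission
  imports Defs
begin

text \<open>
  Write \<open>a\<close>, \<open>b\<close> for the \<open>q\<close>-th powers of the radial functions of \<open>K\<close>, \<open>L\<close>, and \<open>w\<close> for the positive
  weight \<open>\<rho>\<^sub>Q\<close> to the power \<open>n - q\<close>.  In terms of \<open>t = \<rho>\<^sub>M\<^sup>q\<close> the integrand of the mixed volume of \<open>K\<close>
  at a direction \<open>u\<close> is \<open>w * a * \<phi>q (t / a)\<close>, and similarly for \<open>L\<close> with \<open>b\<close>.  The radial function of
  a star body is an arbitrary positive continuous function on the sphere, so the hypothesis can be
  localized: changing \<open>M\<close> only near a direction shows that the difference
  \<open>w * (a * \<phi>q (t / a) - b * \<phi>q (t / b))\<close> is, in each direction, independent of \<open>t > 0\<close>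
  (\<open>constant_if_all_integrals_vanish\<close>).  If \<open>a \<noteq> b\<close> in some direction, this puts three points of the graph
  of \<open>\<phi>q\<close> over a geometric progression of ratio \<open>b / a\<close> on one line, against strict convexity or
  concavity (\<open>strictly_convex_perspective_injective\<close>).  So the radial functions coincide, and a star body
  is determined by its radial function.

  The localization uses three facts about the surface measure of the sphere, which is a
  Hausdorff measure: it is countably additive on the Borel sets (\<open>emeasure_hausdorff_measure\<close>,
  by Caratheodory's criterion), it is finite (\<open>hausdorff_outer_sphere_finite\<close>), so that continuous
  functions are integrable, and it is positive on nonempty relatively open sets
  (\<open>hausdorff_outer_sphere_ball_pos\<close>), so that it detects a difference of continuous functions.  Finiteness comes
  from explicit covers by pieces of a Lipschitz graph, positivity from a comparison with Lebesgue measure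
  of the space through cylinders.
\<close>

section \<open>Hausdorff outer measure\<close>

lemma hausdorff_premeasure_le:
  assumes "A \<subseteq> (\<Union>i. C i)" "\<And>i. bounded (C i)" "\<And>i. diameter (C i) \<le> \<delta>"
  shows "hausdorff_premeasure k \<delta> A \<le> (\<Sum>i. hausdorff_gauge k (C i))"
  unfolding hausdorff_premeasure_def using assms by (intro INF_lower) auto

lemma hausdorff_premeasure_mono:
  assumes "A \<subseteq> B"
  shows "hausdorff_premeasure k \<delta> A \<le> hausdorff_premeasure k \<delta> B"
  unfolding hausdorff_premeasure_def using assms by (intro INF_superset_mono) auto

lemma hausdorff_premeasure_antimono:
  assumes "\<delta> \<le> \<epsilon>"
  shows "hausdorff_premeasure k \<epsilon> A \<le> hausdorff_premeasure k \<delta> A"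
  unfolding hausdorff_premeasure_def using assms by (intro INF_superset_mono) (blast intro: order.trans, simp)

lemma hausdorff_gauge_empty [simp]: "hausdorff_gauge k {} = 0"
  by (simp add: hausdorff_gauge_def)

lemma hausdorff_premeasure_le_sum:
  assumes "finite I" "A \<subseteq> (\<Union>i\<in>I. C i)" "\<And>i. i \<in> I \<Longrightarrow> bounded (C i)"
    "\<And>i. i \<in> I \<Longrightarrow> diameter (C i) \<le> \<delta>" "\<delta> \<ge> 0"
  shows "hausdorff_premeasure k \<delta> A \<le> (\<Sum>i\<in>I. hausdorff_gauge k (C i))"
proof -
  obtain h where h: "bij_betw h {..<card I} I"
    using ex_bij_betw_nat_finite[OF assms(1)] by (auto simp: atLeast0LessThan)
  \<comment> \<open>The finite family is padded to a sequence by empty sets, whose gauge is 0.\<close>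
  define D where "D n = (if n < card I then C (h n) else {})" for n
  have hI: "h n \<in> I" if "n < card I" for n using h that by (auto simp: bij_betw_def)
  have "hausdorff_premeasure k \<delta> A \<le> (\<Sum>n. hausdorff_gauge k (D n))"
  proof (rule hausdorff_premeasure_le)
    show "A \<subseteq> (\<Union>n. D n)"
    proof
      fix x assume "x \<in> A"
      then obtain i where i: "i \<in> I" "x \<in> C i" using assms(2) by auto
      then obtain n where "n < card I" "h n = i"
        using h by (metis bij_betw_imp_surj_on imageE lessThan_iff)
      then show "x \<in> (\<Union>n. D n)" using i by (auto simp: D_def)
    qed
  qed (use assms hI in \<open>auto simp: D_def\<close>)
  also have "\<dots> = (\<Sum>n<card I. hausdorff_gauge k (D n))"
    by (rule suminf_finite) (auto simp: D_def)
  also have "\<dots> = (\<Sum>n<card I. hausdorff_gauge k (C (h n)))" by (simp add: D_def)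
  also have "\<dots> = (\<Sum>i\<in>I. hausdorff_gauge k (C i))"
    by (rule sum.reindex_bij_betw[OF h])
  finally show ?thesis .
qed

lemma hausdorff_premeasure_empty: "\<delta> \<ge> 0 \<Longrightarrow> hausdorff_premeasure k \<delta> {} = 0"
  using hausdorff_premeasure_le_sum[of "{}" "{}" "\<lambda>_. {}" \<delta> k] by simp

lemma hausdorff_premeasure_countably_subadditive:
  "hausdorff_premeasure k \<delta> (\<Union>i. A i) \<le> (\<Sum>i. hausdorff_premeasure k \<delta> (A i))"
    (is "_ \<le> (\<Sum>i. ?P (A i))")
proof (rule ennreal_le_epsilon)
  fix e :: real assume e: "0 < e" and fin: "(\<Sum>i. ?P (A i)) < top"
  have "\<forall>n. \<exists>B. A n \<subseteq> (\<Union>i. B i) \<and> (\<forall>i. bounded (B i) \<and> diameter (B i) \<le> \<delta>) \<and>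
      (\<Sum>i. hausdorff_gauge k (B i)) \<le> ?P (A n) + ennreal (e * (1/2) ^ Suc n)"
  proof
    fix n
    have "?P (A n) < top"
      using fin by (auto dest: ennreal_suminf_lessD)
    then have "?P (A n) < ?P (A n) + ennreal (e * (1/2) ^ Suc n)"
      using e by (cases "?P (A n)") (auto simp: ennreal_plus[symmetric] ennreal_less_iff simp del: ennreal_plus)
    then show "\<exists>B. A n \<subseteq> (\<Union>i. B i) \<and> (\<forall>i. bounded (B i) \<and> diameter (B i) \<le> \<delta>) \<and>
        (\<Sum>i. hausdorff_gauge k (B i)) \<le> ?P (A n) + ennreal (e * (1/2) ^ Suc n)"
      by (subst (asm) (1) hausdorff_premeasure_def) (auto simp: INF_less_iff intro!: less_imp_le)
  qed
  from choice[OF this] obtain B where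
    B: "\<And>n. A n \<subseteq> (\<Union>i. B n i)" "\<And>n i. bounded (B n i)"
      "\<And>n i. diameter (B n i) \<le> \<delta>"
      "\<And>n. (\<Sum>i. hausdorff_gauge k (B n i)) \<le> ?P (A n) + ennreal (e * (1/2) ^ Suc n)"
    by blast
  define C where "C = case_prod B \<circ> prod_decode"
  have "(\<Union>n. A n) \<subseteq> (\<Union>i. C i)"
  proof
    fix x assume "x \<in> (\<Union>n. A n)"
    then obtain n i where "x \<in> B n i" using B(1) by blast
    then have "x \<in> C (prod_encode (n, i))" by (simp add: C_def)
    then show "x \<in> (\<Union>i. C i)" by blast
  qed
  then have "?P (\<Union>n. A n) \<le> (\<Sum>i. hausdorff_gauge k (C i))"
    by (intro hausdorff_premeasure_le) (auto simp: C_def B split: prod.split)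
  also have "\<dots> = (\<Sum>n. \<Sum>i. hausdorff_gauge k (B n i))"
    unfolding C_def comp_def
    using suminf_ennreal_2dimen[of "\<lambda>n. \<Sum>i. hausdorff_gauge k (B n i)"
        "\<lambda>p. hausdorff_gauge k (case_prod B p)"] by simp
  also have "\<dots> \<le> (\<Sum>n. ?P (A n) + ennreal (e * (1/2) ^ Suc n))"
    using B(4) by (intro suminf_le) auto
  also have "\<dots> = (\<Sum>n. ?P (A n)) + (\<Sum>n. ennreal e * ennreal ((1/2) ^ Suc n))"
    using e by (subst suminf_add[symmetric])
      (auto simp del: ennreal_suminf_cmult simp add: ennreal_mult[symmetric])
  also have "\<dots> = (\<Sum>n. ?P (A n)) + e"
    unfolding ennreal_suminf_cmult
    by (subst suminf_ennreal_eq[OF zero_le_power power_half_series]) auto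
  finally show "?P (\<Union>n. A n) \<le> (\<Sum>n. ?P (A n)) + ennreal e" .
qed

lemma hausdorff_outer_mono: "A \<subseteq> B \<Longrightarrow> hausdorff_outer k A \<le> hausdorff_outer k B"
  unfolding hausdorff_outer_def by (intro SUP_mono) (auto intro: hausdorff_premeasure_mono)

lemma hausdorff_outer_empty [simp]: "hausdorff_outer k {} = 0"
  unfolding hausdorff_outer_def by (simp add: hausdorff_premeasure_empty)

lemma hausdorff_premeasure_le_outer:
  "\<delta> > 0 \<Longrightarrow> hausdorff_premeasure k \<delta> A \<le> hausdorff_outer k A"
  unfolding hausdorff_outer_def by (intro SUP_upper) auto

lemma hausdorff_outer_countably_subadditive:
  "hausdorff_outer k (\<Union>i. A i) \<le> (\<Sum>i. hausdorff_outer k (A i))"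
  unfolding hausdorff_outer_def[of k "\<Union>i. A i"]
proof (rule SUP_least)
  fix \<delta> :: real assume "\<delta> \<in> {0<..}"
  then show "hausdorff_premeasure k \<delta> (\<Union>i. A i) \<le> (\<Sum>i. hausdorff_outer k (A i))"
    by (intro order.trans[OF hausdorff_premeasure_countably_subadditive] suminf_le
        hausdorff_premeasure_le_outer) auto
qed

lemma hausdorff_outer_measure_space:
  "outer_measure_space (Pow UNIV) (hausdorff_outer k)"
  unfolding outer_measure_space_def positive_def increasing_def countably_subadditive_def
  by (auto intro: hausdorff_outer_mono hausdorff_outer_countably_subadditive)

lemma hausdorff_outer_Un_le:
  "hausdorff_outer k (A \<union> B) \<le> hausdorff_outer k A + hausdorff_outer k B"
  using hausdorff_outer_countably_subadditive[of k "binaryset A B"]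
  by (simp add: UN_binaryset_eq suminf_binaryset_eq)

text \<open>
  A set of diameter less than \<open>e\<close> meets at most one of \<open>A\<close> and \<open>B\<close>, so a fine cover of the union splits
  into a cover of \<open>A\<close> and one of \<open>B\<close>.
\<close>

lemma hausdorff_outer_separated:
  fixes A B :: "'a::metric_space set"
  assumes "e > 0" and sep: "\<And>x y. x \<in> A \<Longrightarrow> y \<in> B \<Longrightarrow> e \<le> dist x y"
  shows "hausdorff_outer k A + hausdorff_outer k B \<le> hausdorff_outer k (A \<union> B)"
proof -
  have pre: "hausdorff_premeasure k \<delta> A + hausdorff_premeasure k \<delta> B \<le> hausdorff_premeasure k \<delta> (A \<union> B)"
    if \<delta>: "0 < \<delta>" "\<delta> < e" for \<delta>
    unfolding hausdorff_premeasure_def[of k \<delta> "A \<union> B"]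
  proof (rule INF_greatest)
    fix C :: "nat \<Rightarrow> 'a set"
    assume "C \<in> {C. A \<union> B \<subseteq> (\<Union>i. C i) \<and> (\<forall>i. bounded (C i) \<and> diameter (C i) \<le> \<delta>)}"
    then have C: "A \<union> B \<subseteq> (\<Union>i. C i)" "\<And>i. bounded (C i)" "\<And>i. diameter (C i) \<le> \<delta>" by auto
    define CA where "CA i = (if C i \<inter> A = {} then {} else C i)" for i
    define CB where "CB i = (if C i \<inter> B = {} then {} else C i)" for i
    have *: "C i \<inter> A = {} \<or> C i \<inter> B = {}" for i
    proof (rule ccontr)
      assume "\<not> ?thesis"
      then obtain x y where "x \<in> C i" "x \<in> A" "y \<in> C i" "y \<in> B" by auto
      then show False
        using sep[of x y] diameter_bounded_bound[OF C(2), of x i y] C(3)[of i] \<delta> by auto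
    qed
    have "hausdorff_premeasure k \<delta> A \<le> (\<Sum>i. hausdorff_gauge k (CA i))"
      using C \<delta> by (intro hausdorff_premeasure_le) (fastforce simp: CA_def)+
    moreover have "hausdorff_premeasure k \<delta> B \<le> (\<Sum>i. hausdorff_gauge k (CB i))"
      using C \<delta> by (intro hausdorff_premeasure_le) (fastforce simp: CB_def)+
    ultimately have "hausdorff_premeasure k \<delta> A + hausdorff_premeasure k \<delta> B
        \<le> (\<Sum>i. hausdorff_gauge k (CA i)) + (\<Sum>i. hausdorff_gauge k (CB i))"
      by (rule add_mono)
    also have "\<dots> = (\<Sum>i. hausdorff_gauge k (CA i) + hausdorff_gauge k (CB i))"
      by (rule suminf_add) auto
    also have "\<dots> \<le> (\<Sum>i. hausdorff_gauge k (C i))"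
      using * by (intro suminf_le) (auto simp: CA_def CB_def)
    finally show "hausdorff_premeasure k \<delta> A + hausdorff_premeasure k \<delta> B
        \<le> (\<Sum>i. hausdorff_gauge k (C i))" .
  qed
  have "(SUP \<delta>\<in>{0<..}. hausdorff_premeasure k \<delta> A + hausdorff_premeasure k \<delta> B)
      = hausdorff_outer k A + hausdorff_outer k B"
    unfolding hausdorff_outer_def
  proof (rule SUP_add_directed_ennreal)
    fix \<delta> \<epsilon> :: real assume "\<delta> \<in> {0<..}" "\<epsilon> \<in> {0<..}"
    then show "\<exists>\<eta>\<in>{0<..}. hausdorff_premeasure k \<delta> A + hausdorff_premeasure k \<epsilon> B
        \<le> hausdorff_premeasure k \<eta> A + hausdorff_premeasure k \<eta> B"
      by (intro bexI[of _ "min \<delta> \<epsilon>"] add_mono hausdorff_premeasure_antimono) auto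
  qed
  moreover have "hausdorff_premeasure k \<delta> A + hausdorff_premeasure k \<delta> B
      \<le> hausdorff_outer k (A \<union> B)" if "\<delta> > 0" for \<delta>
  proof -
    define \<eta> where "\<eta> = min \<delta> (e / 2)"
    have \<eta>: "0 < \<eta>" "\<eta> < e" "\<eta> \<le> \<delta>" using that assms(1) by (auto simp: \<eta>_def)
    have "hausdorff_premeasure k \<delta> A + hausdorff_premeasure k \<delta> B
        \<le> hausdorff_premeasure k \<eta> A + hausdorff_premeasure k \<eta> B"
      using \<eta> by (intro add_mono hausdorff_premeasure_antimono)
    also have "\<dots> \<le> hausdorff_premeasure k \<eta> (A \<union> B)" using \<eta> by (intro pre)
    also have "\<dots> \<le> hausdorff_outer k (A \<union> B)" using \<eta> by (intro hausdorff_premeasure_le_outer)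
    finally show ?thesis .
  qed
  then have "(SUP \<delta>\<in>{0<..}. hausdorff_premeasure k \<delta> A + hausdorff_premeasure k \<delta> B)
      \<le> hausdorff_outer k (A \<union> B)"
    by (intro SUP_least) simp
  ultimately show ?thesis by simp
qed

section \<open>Borel sets are Caratheodory measurable\<close>

text \<open>
  Additivity on separated sets does not apply directly, as \<open>A - F\<close> may come arbitrarily close to \<open>F\<close>.  So
  \<open>A - F\<close> is exhausted by the sets \<open>B n\<close> of its points at distance at least \<open>1 / (n + 1)\<close> from \<open>F\<close>,
  which are separated from \<open>A \<inter> F\<close>.  The loss in passing from \<open>A - F\<close> to \<open>B n\<close> is a tail of the
  series of the outer measures of the shells \<open>R n = B (n + 1) - B n\<close>.  Two shells of the same parity
  are separated from one another, so that each of the two partial series is bounded by the outer measure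
  of \<open>A\<close>; hence the series converges and its tails vanish.
\<close>

lemma hausdorff_outer_caratheodory:
  fixes F :: "'a::metric_space set"
  assumes "closed F"
  shows "hausdorff_outer k (A \<inter> F) + hausdorff_outer k (A - F) \<le> hausdorff_outer k A"
proof (cases "F = {} \<or> hausdorff_outer k A = top")
  case True
  then show ?thesis by auto
next
  case False
  let ?h = "hausdorff_outer k"
  define B where "B n = {x \<in> A. 1 / real (Suc n) \<le> infdist x F}" for n
  define R where "R n = B (Suc n) - B n" for n
  have B_mono: "B m \<subseteq> B n" if "m \<le> n" for m n
  proof -
    have "1 / real (Suc n) \<le> 1 / real (Suc m)" using that by (intro divide_left_mono) auto
    then show ?thesis by (auto simp: B_def)
  qed
  have far: "1 / real (Suc n) \<le> dist x y" if "x \<in> A \<inter> F" "y \<in> B n" for x y n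
    using that infdist_le[of x F y] by (auto simp: B_def dist_commute)
  have B_le: "?h (A \<inter> F) + ?h (B n) \<le> ?h A" for n
  proof -
    have "?h (A \<inter> F) + ?h (B n) \<le> ?h (A \<inter> F \<union> B n)"
      by (rule hausdorff_outer_separated[of "1 / real (Suc n)"]) (use far in auto)
    also have "\<dots> \<le> ?h A" by (rule hausdorff_outer_mono) (auto simp: B_def)
    finally show ?thesis .
  qed
  \<comment> \<open>For \<open>n > m\<close> the left-hand side is positive: a shell is separated from all earlier ones except the one before it.\<close>
  have R_sep: "1 / real (Suc m) - 1 / real (Suc n) \<le> dist x y"
    if "x \<in> B m" "y \<in> R n" for x y m n
  proof -
    have "1 / real (Suc m) \<le> infdist x F" "infdist y F < 1 / real (Suc n)"
      using that by (auto simp: B_def R_def)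
    moreover have "infdist x F \<le> infdist y F + dist x y" by (rule infdist_triangle)
    ultimately show ?thesis by simp
  qed
  have sums: "(\<Sum>i<N. ?h (R (2 * i + c + 1))) \<le> ?h (B (2 * N + c))" for N c
  proof (induction N)
    case (Suc N)
    have "(\<Sum>i<Suc N. ?h (R (2 * i + c + 1))) \<le> ?h (B (2 * N + c)) + ?h (R (2 * N + c + 1))"
      using Suc.IH by (simp add: add_right_mono)
    also have "\<dots> \<le> ?h (B (2 * N + c) \<union> R (2 * N + c + 1))"
    proof (rule hausdorff_outer_separated)
      show "0 < 1 / real (Suc (2 * N + c)) - 1 / real (Suc (2 * N + c + 1))"
        by (simp add: frac_less2)
    qed (rule R_sep)
    also have "\<dots> \<le> ?h (B (2 * Suc N + c))"
      using B_mono[of "2 * N + c" "2 * Suc N + c"]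
      by (intro hausdorff_outer_mono) (auto simp: R_def)
    finally show ?case .
  qed simp
  have h_B: "?h (B n) \<le> ?h A" for n
    by (rule hausdorff_outer_mono) (auto simp: B_def)
  \<comment> \<open>The shell \<open>R 0\<close> is left out, so that the odd and even shells are the sums above with \<open>c = 0\<close> and \<open>c = 1\<close>.\<close>
  define T where "T = (\<Sum>i. ?h (R (i + 1)))"
  have "T \<le> ?h A + ?h A"
    unfolding T_def
  proof (rule suminf_le_const)
    fix N :: nat
    have "(\<Sum>i<N. ?h (R (i + 1))) \<le> (\<Sum>i<2 * N. ?h (R (i + 1)))"
      by (intro sum_mono2) auto
    also have "\<dots> = (\<Sum>i<N. ?h (R (2 * i + 0 + 1))) + (\<Sum>i<N. ?h (R (2 * i + 1 + 1)))"
      by (induction N) (simp_all add: algebra_simps)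
    also have "\<dots> \<le> ?h A + ?h A"
      by (intro add_mono order.trans[OF sums] h_B)
    finally show "(\<Sum>i<N. ?h (R (i + 1))) \<le> ?h A + ?h A" .
  qed auto
  then have T_fin: "T < top"
    using False by (auto simp: less_top[symmetric] top_unique)
  have tail: "?h (A - F) \<le> ?h (B (N + 1)) + (\<Sum>i. ?h (R (i + N + 1)))" for N
  proof -
    have "A - F \<subseteq> B (N + 1) \<union> (\<Union>i. R (i + N + 1))"
    proof
      fix x assume x: "x \<in> A - F"
      then have "infdist x F > 0"
        using assms False in_closed_iff_infdist_zero[of F x] infdist_nonneg[of x F] by force
      then obtain n0 where "inverse (real (Suc n0)) < infdist x F"
        using reals_Archimedean by blast
      then have "\<exists>n. x \<in> B n" using x by (intro exI[of _ n0]) (auto simp: B_def field_simps)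
      define n where "n = (LEAST n. x \<in> B n)"
      have n: "x \<in> B n" unfolding n_def by (rule LeastI_ex) fact
      have least: "x \<notin> B m" if "m < n" for m using that not_less_Least unfolding n_def by blast
      show "x \<in> B (N + 1) \<union> (\<Union>i. R (i + N + 1))"
      proof (cases "n \<le> N + 1")
        case True
        then show ?thesis using n B_mono by auto
      next
        case False
        then have "x \<in> R ((n - N - 2) + N + 1)"
          using n least[of "n - 1"] by (simp add: R_def Suc_diff_Suc numeral_2_eq_2)
        then show ?thesis by blast
      qed
    qed
    then have "?h (A - F) \<le> ?h (B (N + 1) \<union> (\<Union>i. R (i + N + 1)))"
      by (rule hausdorff_outer_mono)
    also have "\<dots> \<le> ?h (B (N + 1)) + ?h (\<Union>i. R (i + N + 1))"
      by (rule hausdorff_outer_Un_le)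
    also have "\<dots> \<le> ?h (B (N + 1)) + (\<Sum>i. ?h (R (i + N + 1)))"
      by (intro add_left_mono hausdorff_outer_countably_subadditive)
    finally show ?thesis .
  qed
  \<comment> \<open>Instead of letting the tail tend to 0, add the finite total \<open>T\<close> on both sides and cancel it at the end.\<close>
  have "T + (?h (A \<inter> F) + ?h (A - F)) \<le> T + ?h A"
    unfolding T_def
  proof (rule ennreal_suminf_bound_add)
    fix N
    have "(\<Sum>n<N. ?h (R (n + 1))) + (?h (A \<inter> F) + ?h (A - F))
        \<le> (\<Sum>n<N. ?h (R (n + 1))) + (?h (A \<inter> F) + (?h (B (N + 1)) + (\<Sum>i. ?h (R (i + N + 1)))))"
      by (intro add_left_mono tail)
    also have "\<dots> = ((\<Sum>i. ?h (R (i + N + 1))) + (\<Sum>n<N. ?h (R (n + 1)))) + (?h (A \<inter> F) + ?h (B (N + 1)))"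
      by (simp add: ac_simps)
    also have "(\<Sum>i. ?h (R (i + N + 1))) + (\<Sum>n<N. ?h (R (n + 1))) = (\<Sum>i. ?h (R (i + 1)))"
      by (rule suminf_offset[symmetric]) auto
    also have "(\<Sum>i. ?h (R (i + 1))) + (?h (A \<inter> F) + ?h (B (N + 1))) \<le> (\<Sum>i. ?h (R (i + 1))) + ?h A"
      by (intro add_left_mono B_le)
    finally show "(\<Sum>n<N. ?h (R (n + 1))) + (?h (A \<inter> F) + ?h (A - F)) \<le> (\<Sum>i. ?h (R (i + 1))) + ?h A" .
  qed
  then show ?thesis
    using T_fin by (auto simp: ennreal_add_left_cancel_le)
qed

lemma sets_hausdorff_measure [simp, measurable_cong]: "sets (hausdorff_measure k) = sets borel"
  unfolding hausdorff_measure_def using sets.sigma_sets_eq[of borel] by simp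

text \<open>
  A \<open>measure_of\<close> whose set function is not a measure on the given sets is the null measure, so the
  outer measure must first be seen to be countably additive on the Borel sets.  It is so on its
  Caratheodory sets, and these contain the closed sets and therefore all Borel sets.
\<close>

lemma emeasure_hausdorff_measure:
  fixes A :: "'a::metric_space set"
  assumes "A \<in> sets borel"
  shows "emeasure (hausdorff_measure k) A = hausdorff_outer k A"
proof -
  interpret P: sigma_algebra "UNIV :: 'a set" "Pow UNIV" by (rule sigma_algebra_Pow)
  let ?L = "lambda_system UNIV (Pow UNIV) (hausdorff_outer k :: 'a set \<Rightarrow> ennreal)"
  have L: "measure_space UNIV ?L (hausdorff_outer k)"
    using hausdorff_outer_measure_space by (rule P.caratheodory_lemma)
  have "closed F \<Longrightarrow> F \<in> ?L" for F :: "'a set"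
  proof -
    assume F: "closed F"
    have "hausdorff_outer k (A \<inter> F) + hausdorff_outer k (A - F) = hausdorff_outer k A" for A
      using hausdorff_outer_caratheodory[OF F, of k A]
        hausdorff_outer_Un_le[of k "A \<inter> F" "A - F"] by (simp add: Int_Diff_Un antisym)
    then show "F \<in> ?L" unfolding P.lambda_system_eq by simp
  qed
  moreover have "sigma_algebra UNIV ?L" using L by (simp only: measure_space_def)
  ultimately have "sigma_sets UNIV {F :: 'a set. closed F} \<subseteq> ?L"
    by (intro sigma_algebra.sigma_sets_subset) auto
  then have "sets borel \<subseteq> ?L" by (simp add: borel_eq_closed)
  then have "measure_space UNIV (sets borel) (hausdorff_outer k :: 'a set \<Rightarrow> ennreal)"
    using L sets.sigma_algebra_axioms[of "borel :: 'a measure"] by (auto intro: measure_down)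
  then show ?thesis
    unfolding hausdorff_measure_def using assms
    by (intro emeasure_measure_of_sigma) (auto simp: measure_space_def)
qed

section \<open>The unit sphere has finite surface measure\<close>

lemma hausdorff_gauge_le:
  assumes "bounded C" "diameter C \<le> d" "d \<ge> 0"
  shows "hausdorff_gauge k C \<le> ennreal (unit_ball_vol (real k) * (d / 2) ^ k)"
  unfolding hausdorff_gauge_def using assms diameter_ge_0[OF assms(1)]
  by (auto intro!: ennreal_leI mult_left_mono power_mono)

lemma norm_eq_1_iff_sum_squares:
  fixes u :: "real ^ 'n"
  shows "norm u = 1 \<longleftrightarrow> (\<Sum>i\<in>UNIV. (u $ i)\<^sup>2) = 1"
  unfolding norm_vec_def L2_set_def by simp

text \<open>
  Where the coordinate \<open>j\<close> dominates and has a fixed sign, the sphere is a Lipschitz graph over the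
  other coordinates: \<open>u\<^sub>j\<^sup>2 - v\<^sub>j\<^sup>2\<close> is a sum of terms \<open>(v\<^sub>i - u\<^sub>i) (v\<^sub>i + u\<^sub>i)\<close>, and by dominance each
  second factor is at most \<open>\<bar>u\<^sub>j + v\<^sub>j\<bar>\<close>, which cancels.
\<close>

lemma sphere_dominant_coordinate_dist:
  fixes u v :: "real ^ 'n"
  assumes "norm u = 1" "norm v = 1" "s \<in> {-1, 1}"
    and u: "\<And>i. \<bar>u $ i\<bar> \<le> s * u $ j" and v: "\<And>i. \<bar>v $ i\<bar> \<le> s * v $ j"
    and e: "\<And>i. i \<noteq> j \<Longrightarrow> \<bar>u $ i - v $ i\<bar> \<le> e"
  shows "norm (u - v) \<le> 2 * real (CARD('n) - 1) * e"
proof -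
  let ?J = "UNIV - {j}"
  define a b where "a = s * u $ j" and "b = s * v $ j"
  have "a \<ge> 0" "b \<ge> 0" using u[of j] v[of j] by (auto simp: a_def b_def)
  have "a > 0"
  proof (rule ccontr)
    assume "\<not> a > 0"
    then have "u $ i = 0" for i using u[of i] by (auto simp: a_def)
    then have "u = 0" by (simp add: vec_eq_iff)
    then show False using assms(1) by simp
  qed
  have sq: "a\<^sup>2 = (u $ j)\<^sup>2" "b\<^sup>2 = (v $ j)\<^sup>2" "\<bar>u $ j - v $ j\<bar> = \<bar>a - b\<bar>"
    using assms(3) by (auto simp: a_def b_def)
  have "(u $ j)\<^sup>2 + (\<Sum>i\<in>?J. (u $ i)\<^sup>2) = (v $ j)\<^sup>2 + (\<Sum>i\<in>?J. (v $ i)\<^sup>2)"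
    using assms(1,2) by (simp add: norm_eq_1_iff_sum_squares sum.remove[of UNIV j])
  then have "a\<^sup>2 - b\<^sup>2 = (\<Sum>i\<in>?J. (v $ i)\<^sup>2 - (u $ i)\<^sup>2)"
    by (simp add: sq sum_subtractf)
  then have "\<bar>a\<^sup>2 - b\<^sup>2\<bar> \<le> (\<Sum>i\<in>?J. \<bar>(v $ i)\<^sup>2 - (u $ i)\<^sup>2\<bar>)"
    by (simp add: sum_abs)
  also have "\<dots> \<le> (\<Sum>i\<in>?J. e * (a + b))"
  proof (rule sum_mono)
    fix i assume i: "i \<in> ?J"
    have "\<bar>(v $ i)\<^sup>2 - (u $ i)\<^sup>2\<bar> = \<bar>u $ i - v $ i\<bar> * \<bar>u $ i + v $ i\<bar>"
      by (simp add: abs_mult[symmetric] abs_minus_commute power2_eq_square algebra_simps)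
    also have "\<dots> \<le> e * (a + b)"
      using e[of i] i u[of i] v[of i] by (intro mult_mono) (auto simp: a_def b_def)
    finally show "\<bar>(v $ i)\<^sup>2 - (u $ i)\<^sup>2\<bar> \<le> e * (a + b)" .
  qed
  also have "\<dots> = (real (CARD('n) - 1) * e) * (a + b)" by simp
  finally have "\<bar>a - b\<bar> * (a + b) \<le> (real (CARD('n) - 1) * e) * (a + b)"
    using \<open>a \<ge> 0\<close> \<open>b \<ge> 0\<close>
    by (simp add: abs_mult power2_eq_square square_diff_square_factored abs_of_nonneg mult.commute)
  then have ab: "\<bar>u $ j - v $ j\<bar> \<le> real (CARD('n) - 1) * e"
    using \<open>a > 0\<close> \<open>b \<ge> 0\<close> sq(3) by simp
  have "norm (u - v) \<le> (\<Sum>i\<in>UNIV. \<bar>(u - v) $ i\<bar>)" by (rule norm_le_l1_cart)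
  also have "\<dots> = \<bar>u $ j - v $ j\<bar> + (\<Sum>i\<in>?J. \<bar>u $ i - v $ i\<bar>)"
    by (simp add: sum.remove[of UNIV j])
  also have "\<dots> \<le> real (CARD('n) - 1) * e + (\<Sum>i\<in>?J. e)"
    using ab e by (intro add_mono sum_mono) auto
  also have "\<dots> = 2 * real (CARD('n) - 1) * e" by simp
  finally show ?thesis .
qed

text \<open>
  Sorting the points of the sphere by their dominant coordinate, its sign, and the cell of a grid of mesh
  \<open>1 / m\<close> that contains the \<open>k = n - 1\<close> other coordinates gives \<open>O(m\<^sup>k)\<close> pieces of diameter \<open>O(1 / m)\<close>.
  Their gauges add up to a bound independent of \<open>m\<close>.
\<close>

lemma hausdorff_outer_sphere_finite:
  "hausdorff_outer (CARD('n) - 1) (sphere 0 1 :: (real ^ 'n) set) < top"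
proof -
  define k where "k = CARD('n) - 1"
  define c where "c = 2 * real CARD('n) * (unit_ball_vol (real k) * (3 * real k) ^ k)"
  have "hausdorff_premeasure k \<delta> (sphere 0 1 :: (real ^ 'n) set) \<le> ennreal c" if "\<delta> > 0" for \<delta>
  proof -
    obtain m0 :: nat where m0: "2 * real k / \<delta> < real m0" using reals_Archimedean2 by blast
    define m where "m = Suc m0"
    have m: "m \<ge> 1" "2 * real k / real m \<le> \<delta>"
      using m0 that by (auto simp: m_def field_simps)
    \<comment> \<open>A piece is given by the dominant coordinate, its sign, and the grid cell of the other coordinates.\<close>
    define I where "I = (SIGMA j : (UNIV :: 'n set). {-1, 1 :: real} \<times>
      (UNIV - {j} \<rightarrow>\<^sub>E {- int m .. int m}))"
    define C where "C = (\<lambda>(j :: 'n, s :: real, z). {u :: real ^ 'n. norm u = 1 \<and>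
      (\<forall>i. \<bar>u $ i\<bar> \<le> s * u $ j) \<and> (\<forall>i. i \<noteq> j \<longrightarrow> \<lfloor>real m * u $ i\<rfloor> = z i)})"
    have fin: "finite I" unfolding I_def by (intro finite_SigmaI finite_cartesian_product finite_PiE) auto
    have card: "card I = CARD('n) * (2 * (2 * m + 1) ^ k)"
    proof -
      have "nat (int m - - int m + 1) = 2 * m + 1" by simp
      then have "card ({-1, 1 :: real} \<times> (UNIV - {j :: 'n} \<rightarrow>\<^sub>E {- int m .. int m})) = 2 * (2 * m + 1) ^ k" for j
        by (simp add: card_cartesian_product card_PiE k_def)
      then show ?thesis unfolding I_def by (subst card_SigmaI) (auto intro!: finite_PiE)
    qed
    have cover: "sphere 0 1 \<subseteq> (\<Union>i\<in>I. C i)"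
    proof
      fix u :: "real ^ 'n" assume "u \<in> sphere 0 1"
      then have u: "norm u = 1" by simp
      obtain j where j: "\<And>i. \<bar>u $ i\<bar> \<le> \<bar>u $ j\<bar>"
      proof -
        have "Max (range (\<lambda>i. \<bar>u $ i\<bar>)) \<in> range (\<lambda>i. \<bar>u $ i\<bar>)" by (intro Max_in) auto
        then obtain j where "Max (range (\<lambda>i. \<bar>u $ i\<bar>)) = \<bar>u $ j\<bar>" by (rule imageE)
        then have "\<And>i. \<bar>u $ i\<bar> \<le> \<bar>u $ j\<bar>" by (metis Max_ge finite finite_imageI rangeI)
        then show ?thesis by (rule that)
      qed
      define s where "s = (if u $ j \<ge> 0 then 1 else - 1 :: real)"
      define z where "z = restrict (\<lambda>i. \<lfloor>real m * u $ i\<rfloor>) (UNIV - {j})"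
      have "\<lfloor>real m * u $ i\<rfloor> \<in> {- int m .. int m}" for i
      proof -
        have "\<bar>u $ i\<bar> \<le> 1" using component_le_norm_cart[of u i] u by simp
        then have "\<bar>real m * u $ i\<bar> \<le> real m" using mult_left_mono[of "\<bar>u $ i\<bar>" 1 "real m"] by (simp add: abs_mult)
        then show ?thesis by (auto simp: le_floor_iff floor_le_iff abs_le_iff)
      qed
      then have "(j, s, z) \<in> I" by (auto simp: I_def s_def z_def)
      moreover have "s * u $ j = \<bar>u $ j\<bar>" by (simp add: s_def)
      then have "u \<in> C (j, s, z)"
        using u j by (simp add: C_def z_def)
      ultimately show "u \<in> (\<Union>i\<in>I. C i)" by blast
    qed
    have close: "norm (u - v) \<le> 2 * real k / real m" if "p \<in> I" "u \<in> C p" "v \<in> C p" for p u v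
    proof -
      obtain j s z where p: "p = (j, s, z)" by (metis prod_cases3)
      have "\<bar>u $ i - v $ i\<bar> \<le> 1 / real m" if "i \<noteq> j" for i
      proof -
        have "\<lfloor>real m * u $ i\<rfloor> = \<lfloor>real m * v $ i\<rfloor>"
          using \<open>u \<in> C p\<close> \<open>v \<in> C p\<close> that by (auto simp: C_def p)
        then have "\<bar>real m * u $ i - real m * v $ i\<bar> \<le> 1" by linarith
        then have "real m * \<bar>u $ i - v $ i\<bar> \<le> 1"
          by (simp add: right_diff_distrib[symmetric] abs_mult)
        then show ?thesis using m by (simp add: field_simps)
      qed
      then have "norm (u - v) \<le> 2 * real (CARD('n) - 1) * (1 / real m)"
        using that by (intro sphere_dominant_coordinate_dist[of u v s j]) (auto simp: C_def p I_def)
      then show ?thesis by (simp add: k_def)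
    qed
    have bd: "bounded (C p)" for p
      by (rule bounded_subset[OF bounded_sphere[of 0 1]]) (auto simp: C_def split: prod.splits)
    have diam: "diameter (C p) \<le> 2 * real k / real m" if "p \<in> I" for p
      using close[OF that] by (intro diameter_le) auto
    have "hausdorff_premeasure k \<delta> (sphere 0 1 :: (real ^ 'n) set) \<le> (\<Sum>p\<in>I. hausdorff_gauge k (C p))"
      using diam m that bd cover fin by (intro hausdorff_premeasure_le_sum) (auto intro: order.trans)
    also have "\<dots> \<le> (\<Sum>p\<in>I. ennreal (unit_ball_vol (real k) * ((2 * real k / real m) / 2) ^ k))"
      using diam bd by (intro sum_mono hausdorff_gauge_le) auto
    also have "\<dots> = ennreal (real (card I) * (unit_ball_vol (real k) * (real k / real m) ^ k))"
      by (simp add: ennreal_mult ennreal_of_nat_eq_real_of_nat[symmetric])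
    also have "\<dots> \<le> ennreal c"
    proof (rule ennreal_leI)
      have "real (card I) * (unit_ball_vol (real k) * (real k / real m) ^ k)
          = 2 * real CARD('n) * (unit_ball_vol (real k) * ((2 * real m + 1) * (real k / real m)) ^ k)"
        unfolding power_mult_distrib[of "2 * real m + 1"] by (simp add: card add.commute)
      also have "\<dots> \<le> c"
        unfolding c_def
      proof (intro mult_left_mono power_mono)
        have "(2 * real m + 1) / real m \<le> 3" using m by (simp add: field_simps)
        then show "(2 * real m + 1) * (real k / real m) \<le> 3 * real k"
          using mult_right_mono[of "(2 * real m + 1) / real m" 3 "real k"] by simp
      qed auto
      finally show "real (card I) * (unit_ball_vol (real k) * (real k / real m) ^ k) \<le> c" .
    qed
    finally show ?thesis .
  qed
  then have "hausdorff_outer k (sphere 0 1 :: (real ^ 'n) set) \<le> ennreal c"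
    unfolding hausdorff_outer_def by (intro SUP_least) auto
  then show ?thesis unfolding k_def by (rule order.strict_trans1) simp
qed

section \<open>Relatively open pieces of the sphere have positive measure\<close>

text \<open>
  The cylinder of length 2 over the projection of \<open>C\<close> along the axis \<open>j\<close> lies in a box with the side 2
  along that axis and sides \<open>2 * diameter C\<close> along all others.  In this way a cover in the sense of
  Hausdorff measure is compared with Lebesgue measure of the whole space, and no Lebesgue measure on a
  hyperplane is involved.  The constant is the quotient of the volume \<open>2 * (2 * d)\<^sup>k\<close> of the box by
  the gauge of a set of diameter \<open>d\<close>.
\<close>

lemma content_cylinder_le_gauge:
  fixes C :: "(real ^ 'n) set" and c :: real
  assumes "bounded C"
  obtains B where "B \<in> sets lborel" "{x. \<bar>x $ j - c\<bar> \<le> 1 \<and> (\<exists>y\<in>C. \<forall>i. i \<noteq> j \<longrightarrow> y $ i = x $ i)} \<subseteq> B"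
    "emeasure lborel B \<le> ennreal (2 * 4 ^ (CARD('n) - 1) / unit_ball_vol (real (CARD('n) - 1)))
        * hausdorff_gauge (CARD('n) - 1) C"
proof (cases "C = {}")
  case True
  then show ?thesis using that[of "{}"] by simp
next
  case False
  define k where "k = CARD('n) - 1"
  define d where "d = diameter C"
  have d: "d \<ge> 0" unfolding d_def using assms by (rule diameter_ge_0)
  obtain p where p: "p \<in> C" using False by auto
  define a b :: "real ^ 'n" where "a = (\<chi> i. if i = j then c - 1 else p $ i - d)"
    and "b = (\<chi> i. if i = j then c + 1 else p $ i + d)"
  have ab: "a $ i \<le> b $ i" for i using d by (simp add: a_def b_def)
  have "measure lborel (cbox a b) = (\<Prod>i\<in>UNIV. b $ i - a $ i)"
    using ab by (intro content_cbox_cart) (simp add: interval_ne_empty_cart)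
  also have "\<dots> = (b $ j - a $ j) * (\<Prod>i\<in>UNIV - {j}. b $ i - a $ i)"
    by (simp add: prod.remove)
  also have "(\<Prod>i\<in>UNIV - {j}. b $ i - a $ i) = (\<Prod>i\<in>UNIV - {j}. 2 * d)"
    by (intro prod.cong) (auto simp: a_def b_def)
  also have "(b $ j - a $ j) * (\<Prod>i\<in>UNIV - {j}. 2 * d) = 2 * (2 * d) ^ k"
    by (simp add: a_def b_def k_def)
  finally have content: "measure lborel (cbox a b) = 2 * (2 * d) ^ k" .
  show ?thesis
  proof (rule that[of "cbox a b"])
    show "{x. \<bar>x $ j - c\<bar> \<le> 1 \<and> (\<exists>y\<in>C. \<forall>i. i \<noteq> j \<longrightarrow> y $ i = x $ i)} \<subseteq> cbox a b"
    proof safe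
      fix x y assume x: "\<bar>x $ j - c\<bar> \<le> 1" and y: "y \<in> C" "\<forall>i. i \<noteq> j \<longrightarrow> y $ i = x $ i"
      have "\<bar>x $ i - p $ i\<bar> \<le> d" if "i \<noteq> j" for i
      proof -
        have "\<bar>(y - p) $ i\<bar> \<le> norm (y - p)" by (rule component_le_norm_cart)
        also have "\<dots> \<le> d" unfolding d_def dist_norm[symmetric]
          using assms y(1) p by (rule diameter_bounded_bound)
        finally show ?thesis using y that by simp
      qed
      then show "x \<in> cbox a b" using x
        by (auto simp: mem_box_cart a_def b_def abs_le_iff algebra_simps)
    qed
    have pos: "unit_ball_vol (real k) > 0" by simp
    have "emeasure lborel (cbox a b) = ennreal (measure lborel (cbox a b))"
      by (rule emeasure_eq_ennreal_measure) (use emeasure_lborel_cbox_finite[of a b] in \<open>simp add: less_top\<close>)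
    also have "\<dots> = ennreal (2 * 4 ^ k / unit_ball_vol (real k) * (unit_ball_vol (real k) * (d / 2) ^ k))"
    proof -
      have "(4 :: real) ^ k * (d / 2) ^ k = (2 * d) ^ k"
        using power_mult_distrib[of 4 "d / 2" k] by simp
      moreover have "2 * 4 ^ k / \<omega> * (\<omega> * (d / 2) ^ k) = 2 * (4 ^ k * (d / 2) ^ k)" if "\<omega> > 0" for \<omega> :: real
        using that by simp
      ultimately show ?thesis using pos unfolding content by metis
    qed
    also have "\<dots> = ennreal (2 * 4 ^ k / unit_ball_vol (real k)) * hausdorff_gauge k C"
      using False d by (subst ennreal_mult) (auto simp: hausdorff_gauge_def d_def)
    finally show "emeasure lborel (cbox a b) \<le> ennreal (2 * 4 ^ (CARD('n) - 1) /
        unit_ball_vol (real (CARD('n) - 1))) * hausdorff_gauge (CARD('n) - 1) C"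
      by (simp add: k_def)
  qed simp
qed

text \<open>
  Near \<open>u\<close>, let \<open>T\<close> move each point of the space along an axis \<open>j\<close> with \<open>u\<^sub>j \<noteq> 0\<close> to the sphere.
  It is continuous and fixes \<open>u\<close>, so it sends a small ball \<open>W\<close> around \<open>u\<close> into the piece of the sphere.
  Hence the cylinders over the sets of any cover of this piece cover \<open>W\<close>, and the total gauge of the
  cover is at least a fixed multiple of the volume of \<open>W\<close>.
\<close>

lemma hausdorff_outer_sphere_ball_pos:
  fixes u :: "real ^ 'n"
  assumes "norm u = 1" "r > 0"
  shows "hausdorff_outer (CARD('n) - 1) (sphere 0 1 \<inter> ball u r) > 0"
proof -
  define k where "k = CARD('n) - 1"
  have "u \<noteq> 0" using assms by auto
  then obtain j where j: "u $ j \<noteq> 0" by (auto simp: vec_eq_iff)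
  let ?J = "UNIV - {j}"
  define g where "g x = 1 - (\<Sum>i\<in>?J. (x $ i)\<^sup>2)" for x :: "real ^ 'n"
  define T where "T x = (\<chi> i. if i = j then sgn (u $ j) * sqrt (g x) else x $ i)" for x :: "real ^ 'n"
  have g_cont: "isCont g x" for x unfolding g_def by (intro continuous_intros)
  have gu: "g u = (u $ j)\<^sup>2"
    using assms(1) by (simp add: g_def norm_eq_1_iff_sum_squares sum.remove[of UNIV j])
  have Tu: "T u = u"
    by (simp add: T_def gu vec_eq_iff sgn_mult_abs)
  have "isCont T u"
    unfolding T_def isCont_def
  proof (intro tendsto_vec_lambda)
    fix i
    show "(\<lambda>x. if i = j then sgn (u $ j) * sqrt (g x) else x $ i) \<midarrow>u\<rightarrow>
        (if i = j then sgn (u $ j) * sqrt (g u) else u $ i)"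
      using g_cont[of u] by (auto simp: isCont_def intro!: tendsto_intros)
  qed
  then have "\<forall>\<^sub>F x in at u. dist (T x) u < r"
    using assms(2) Tu by (auto simp: isCont_def tendsto_iff)
  moreover have "\<forall>\<^sub>F x in at u. g x > 0"
    using g_cont[of u] j gu by (intro order_tendstoD) (auto simp: isCont_def)
  ultimately have "\<forall>\<^sub>F x in at u. dist (T x) u < r \<and> g x > 0" by eventually_elim simp
  then obtain e where e: "e > 0" "\<And>x. x \<noteq> u \<Longrightarrow> dist x u < e \<Longrightarrow> dist (T x) u < r \<and> g x > 0"
    by (auto simp: eventually_at)
  define W where "W = ball u (min e 1)"
  have TW: "T x \<in> sphere 0 1 \<inter> ball u r" if "x \<in> W" for x
  proof -
    have "dist (T x) u < r \<and> g x > 0"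
      using e(2)[of x] that Tu gu j assms(2) by (cases "x = u") (auto simp: W_def dist_commute)
    moreover from this have "norm (T x) = 1"
      unfolding norm_eq_1_iff_sum_squares using j
      by (simp add: sum.remove[of UNIV j] T_def power_mult_distrib g_def sgn_if)
    ultimately show ?thesis by (simp add: dist_commute)
  qed
  define \<kappa> where "\<kappa> = 2 * 4 ^ k / unit_ball_vol (real k)"
  have "\<kappa> > 0" by (simp add: \<kappa>_def)
  have vol: "emeasure lborel W \<le> ennreal \<kappa> * (\<Sum>i. hausdorff_gauge k (C i))"
    if C: "sphere 0 1 \<inter> ball u r \<subseteq> (\<Union>i. C i)" "\<And>i. bounded (C i)" for C :: "nat \<Rightarrow> (real ^ 'n) set"
  proof -
    have "\<forall>i. \<exists>B. B \<in> sets lborel \<and> {x. \<bar>x $ j - u $ j\<bar> \<le> 1 \<and> (\<exists>y\<in>C i. \<forall>l. l \<noteq> j \<longrightarrow> y $ l = x $ l)} \<subseteq> B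
        \<and> emeasure lborel B \<le> ennreal \<kappa> * hausdorff_gauge k (C i)"
    proof
      fix i
      show "\<exists>B. B \<in> sets lborel \<and> {x. \<bar>x $ j - u $ j\<bar> \<le> 1 \<and> (\<exists>y\<in>C i. \<forall>l. l \<noteq> j \<longrightarrow> y $ l = x $ l)} \<subseteq> B
          \<and> emeasure lborel B \<le> ennreal \<kappa> * hausdorff_gauge k (C i)"
        unfolding \<kappa>_def k_def
        by (rule content_cylinder_le_gauge[OF C(2)[of i], of j "u $ j"]) (rule exI, intro conjI)
    qed
    from choice[OF this] obtain B where B: "\<And>i. B i \<in> sets lborel"
      "\<And>i. {x. \<bar>x $ j - u $ j\<bar> \<le> 1 \<and> (\<exists>y\<in>C i. \<forall>l. l \<noteq> j \<longrightarrow> y $ l = x $ l)} \<subseteq> B i"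
      "\<And>i. emeasure lborel (B i) \<le> ennreal \<kappa> * hausdorff_gauge k (C i)" by blast
    have "W \<subseteq> (\<Union>i. B i)"
    proof
      fix x assume x: "x \<in> W"
      then obtain i where i: "T x \<in> C i" using TW C(1) by blast
      have "\<bar>x $ j - u $ j\<bar> \<le> 1"
        using x component_le_norm_cart[of "x - u" j] by (simp add: W_def dist_norm norm_minus_commute)
      moreover have "\<forall>l. l \<noteq> j \<longrightarrow> T x $ l = x $ l" by (simp add: T_def)
      ultimately have "x \<in> B i" using i B(2)[of i] by blast
      then show "x \<in> (\<Union>i. B i)" by blast
    qed
    then have "emeasure lborel W \<le> emeasure lborel (\<Union>i. B i)"
      using B(1) by (intro emeasure_mono) auto
    also have "\<dots> \<le> (\<Sum>i. emeasure lborel (B i))"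
      using B(1) by (intro emeasure_subadditive_countably) auto
    also have "\<dots> \<le> (\<Sum>i. ennreal \<kappa> * hausdorff_gauge k (C i))"
      using B(3) by (intro suminf_le) auto
    finally show ?thesis by simp
  qed
  show ?thesis
  proof (rule ccontr)
    assume "\<not> ?thesis"
    then have "hausdorff_premeasure k 1 (sphere 0 1 \<inter> ball u r) = 0"
      using hausdorff_premeasure_le_outer[of 1 k "sphere 0 1 \<inter> ball u r"] by (simp add: k_def)
    moreover have posW: "emeasure lborel W > 0"
      unfolding W_def using e(1) by (subst emeasure_ball) auto
    ultimately have "hausdorff_premeasure k 1 (sphere 0 1 \<inter> ball u r) < emeasure lborel W / ennreal \<kappa>"
      by (simp add: ennreal_zero_less_divide)
    then obtain C :: "nat \<Rightarrow> (real ^ 'n) set" where C: "sphere 0 1 \<inter> ball u r \<subseteq> (\<Union>i. C i)" "\<And>i. bounded (C i)"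
      "(\<Sum>i. hausdorff_gauge k (C i)) < emeasure lborel W / ennreal \<kappa>"
      unfolding hausdorff_premeasure_def INF_less_iff by blast
    have "ennreal \<kappa> * (\<Sum>i. hausdorff_gauge k (C i)) < ennreal \<kappa> * (emeasure lborel W / ennreal \<kappa>)"
      using C(3) \<open>\<kappa> > 0\<close> by (intro ennreal_mult_strict_left_mono) auto
    also have "\<dots> = emeasure lborel W"
      using \<open>\<kappa> > 0\<close>
      by (subst ennreal_times_divide, subst mult.commute, intro ennreal_mult_divide_eq) auto
    finally show False using vol[OF C(1,2)] by simp
  qed
qed

section \<open>Integral equations for all positive continuous functions\<close>

lemma set_integrable_continuous_on_compact:
  fixes f :: "'a::metric_space \<Rightarrow> real"
  assumes M: "sets M = sets borel" and S: "compact S" "emeasure M S < top"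
    and f: "continuous_on S f"
  shows "set_integrable M S f"
proof -
  have "bounded (f ` S)" using compact_continuous_image[OF f S(1)] by (rule compact_imp_bounded)
  then obtain B where B: "\<And>x. x \<in> S \<Longrightarrow> norm (f x) \<le> B" by (auto simp: bounded_iff)
  have "S \<in> sets borel" using S by (simp add: borel_compact)
  then have "(\<lambda>x. indicator S x *\<^sub>R f x) \<in> borel_measurable M"
    using borel_measurable_continuous_on_indicator[of S f] f measurable_cong_sets[OF M refl] by blast
  then show ?thesis
    unfolding set_integrable_def using S B M \<open>S \<in> sets borel\<close>
    by (intro integrableI_bounded_set[where A = S and B = B]) (auto simp: indicator_def)
qed

lemma continuous_on_along_graph:
  assumes "continuous_on (S \<times> T) (\<lambda>(u, t). F u t)" "continuous_on S g" "\<And>u. u \<in> S \<Longrightarrow> g u \<in> T"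
  shows "continuous_on S (\<lambda>u. F u (g u))"
proof -
  have "continuous_on S ((\<lambda>(u, t). F u t) \<circ> (\<lambda>u. (u, g u)))"
    using assms
    by (intro continuous_on_compose continuous_on_subset[OF assms(1)] continuous_intros) auto
  then show ?thesis by (simp add: comp_def)
qed

text \<open>
  Start from the constant function \<open>s\<close> and change it to \<open>t\<close> on the ball of radius \<open>r\<close> around \<open>u\<close> only,
  by the cut-offs \<open>\<eta> k\<close>, which increase to the indicator function of the ball.  By dominated convergence
  the integral of \<open>F v t - F v s\<close> over the ball vanishes.  If \<open>F u t - F u s\<close> were positive, the
  integrand would be positive on a small ball, and its integral too.
\<close>

lemma constant_if_all_integrals_vanish:
  fixes F :: "'a::metric_space \<Rightarrow> real \<Rightarrow> real"
  assumes M: "sets M = sets borel" and S: "compact S" "emeasure M S < top"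
    and pos: "\<And>u r. u \<in> S \<Longrightarrow> r > 0 \<Longrightarrow> emeasure M (S \<inter> ball u r) > 0"
    and F: "continuous_on (S \<times> {0<..}) (\<lambda>(u, t). F u t)"
    and zero: "\<And>g. continuous_on S g \<Longrightarrow> (\<And>u. u \<in> S \<Longrightarrow> g u > 0) \<Longrightarrow>
      set_lebesgue_integral M S (\<lambda>u. F u (g u)) = 0"
    and "u \<in> S" "s > 0" "t > 0"
  shows "F u s = F u t"
proof -
  have F_comp: "continuous_on S (\<lambda>v. F v (g v))"
    if "continuous_on S g" "\<And>v. v \<in> S \<Longrightarrow> g v > 0" for g
    by (rule continuous_on_along_graph[OF F]) (use that in auto)
  have S_borel: "S \<in> sets M" using S M by (simp add: borel_compact)
  have "F u t \<le> F u s" if st: "s > 0" "t > 0" for s t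
  proof (rule ccontr)
    assume "\<not> F u t \<le> F u s"
    define D where "D v = F v t - F v s" for v
    have D_cont: "continuous_on S D"
      unfolding D_def using st by (intro continuous_intros F_comp) auto
    have "D u > 0" using \<open>\<not> F u t \<le> F u s\<close> by (simp add: D_def)
    then have "\<forall>\<^sub>F v in at u within S. D v > 0"
      using D_cont \<open>u \<in> S\<close> by (intro order_tendstoD) (auto simp: continuous_on_def)
    then obtain r where r: "r > 0" "\<And>v. v \<in> S \<Longrightarrow> v \<noteq> u \<Longrightarrow> dist v u < r \<Longrightarrow> D v > 0"
      by (auto simp: eventually_at)
    then have D_pos: "D v > 0" if "v \<in> S \<inter> ball u r" for v
      using that \<open>D u > 0\<close> by (cases "v = u") (auto simp: dist_commute)
    define \<eta> where "\<eta> k v = min 1 (real k * max 0 (r - dist v u))" for k v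
    define g where "g k v = s + \<eta> k v * (t - s)" for k v
    have \<eta>: "0 \<le> \<eta> k v" "\<eta> k v \<le> 1" for k v by (auto simp: \<eta>_def)
    have g_range: "g k v \<in> {min s t .. max s t}" for k v
    proof -
      have "g k v \<in> closed_segment s t"
        using \<eta>[of k v] by (auto simp: in_segment g_def algebra_simps intro!: exI[of _ "\<eta> k v"])
      then show ?thesis by (simp add: closed_segment_eq_real_ivl split: if_splits)
    qed
    have g_pos: "g k v > 0" for k v using g_range[of k v] st by auto
    have g_cont: "continuous_on S (g k)" for k
      unfolding g_def \<eta>_def by (intro continuous_intros)
    define h where "h k v = F v (g k v) - F v s" for k v
    have int_g: "set_integrable M S (\<lambda>v. F v (g k v))" "set_integrable M S (\<lambda>v. F v s)" for k
      using g_pos g_cont st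
      by (auto intro!: set_integrable_continuous_on_compact[OF M S] F_comp)
    have h_int: "set_lebesgue_integral M S (h k) = 0" for k
      unfolding h_def using zero[of "g k"] zero[of "\<lambda>_. s"] g_cont g_pos st
      by (subst set_integral_diff(2)[OF int_g]) auto
    have "compact (S \<times> {min s t .. max s t})" using S by (intro compact_Times) auto
    moreover have "continuous_on (S \<times> {min s t .. max s t}) (\<lambda>(u, t). F u t)"
      using st by (intro continuous_on_subset[OF F]) auto
    ultimately have "bounded ((\<lambda>(u, t). F u t) ` (S \<times> {min s t .. max s t}))"
      by (intro compact_imp_bounded compact_continuous_image)
    then obtain B where B: "\<And>v \<tau>. v \<in> S \<Longrightarrow> \<tau> \<in> {min s t .. max s t} \<Longrightarrow> \<bar>F v \<tau>\<bar> \<le> B"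
      by (force simp: bounded_iff)
    have h_bound: "\<bar>h k v\<bar> \<le> 2 * B" if "v \<in> S" for k v
      using B[OF that g_range[of k v]] B[OF that, of s] by (simp add: h_def)
    define f where "f v = indicator S v *\<^sub>R (indicator (ball u r) v * D v)" for v
    have f_eq: "f = (\<lambda>v. indicator (ball u r) v * (indicator S v *\<^sub>R D v))"
      by (auto simp: f_def indicator_def)
    have meas_D: "(\<lambda>v. indicator S v *\<^sub>R D v) \<in> borel_measurable M"
      using set_integrable_continuous_on_compact[OF M S D_cont]
      by (auto simp: set_integrable_def)
    have f_meas: "f \<in> borel_measurable M"
      unfolding f_eq using meas_D M by (intro borel_measurable_times borel_measurable_indicator) auto
    have lim: "(\<lambda>k. indicator S v *\<^sub>R h k v) \<longlonglongrightarrow> f v" for v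
    proof (cases "v \<in> ball u r")
      case True
      then have r': "r - dist v u > 0" by (simp add: dist_commute)
      obtain k0 :: nat where k0: "1 / (r - dist v u) < real k0" using reals_Archimedean2 by blast
      have "\<eta> k v = 1" if "k \<ge> k0" for k
      proof -
        have "1 \<le> real k0 * (r - dist v u)" using k0 r' by (simp add: field_simps)
        also have "\<dots> \<le> real k * (r - dist v u)" using that r' by (intro mult_right_mono) auto
        finally show ?thesis using r' by (simp add: \<eta>_def)
      qed
      then have "\<forall>\<^sub>F k in sequentially. indicator S v *\<^sub>R h k v = f v"
        using True by (auto simp: f_def h_def g_def D_def intro!: eventually_sequentiallyI[of k0])
      then show ?thesis by (rule tendsto_eventually)
    next
      case False
      then have "\<eta> k v = 0" for k by (simp add: \<eta>_def dist_commute)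
      then show ?thesis using False by (simp add: f_def h_def g_def)
    qed
    have w: "integrable M (\<lambda>v. 2 * B * indicator S v :: real)"
      using S S_borel by (intro integrable_mult_right integrable_real_indicator) (auto simp: infinity_ennreal_def)
    have h_meas: "(\<lambda>v. indicator S v *\<^sub>R h k v) \<in> borel_measurable M" for k
      using set_integral_diff(1)[OF int_g(1)[of k] int_g(2)] unfolding h_def set_integrable_def by auto
    have lim_AE: "AE v in M. (\<lambda>k. indicator S v *\<^sub>R h k v) \<longlonglongrightarrow> f v"
      using lim by (intro AE_I2)
    have bound_AE: "AE v in M. norm (indicator S v *\<^sub>R h k v) \<le> 2 * B * indicator S v" for k
      using h_bound by (intro AE_I2) (auto simp: indicator_def)
    have "(\<lambda>k. \<integral>v. indicator S v *\<^sub>R h k v \<partial>M) \<longlonglongrightarrow> (\<integral>v. f v \<partial>M)"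
      by (rule integral_dominated_convergence[OF f_meas h_meas w lim_AE bound_AE])
    then have "(\<integral>v. f v \<partial>M) = 0"
      using h_int unfolding set_lebesgue_integral_def by (simp add: LIMSEQ_const_iff)
    moreover have "integrable M f"
      by (rule integrable_dominated_convergence[OF f_meas h_meas w lim_AE bound_AE])
    moreover have "f v \<ge> 0" for v
      using D_pos[of v] by (auto simp: f_def indicator_def)
    ultimately have "AE v in M. f v = 0" by (simp add: integral_nonneg_eq_0_iff_AE)
    then have "AE v in M. v \<notin> S \<inter> ball u r"
      by eventually_elim (use D_pos in \<open>force simp: f_def\<close>)
    then have "S \<inter> ball u r \<in> null_sets M"
      using S_borel M by (subst AE_iff_null_sets) auto
    then show False using pos[OF \<open>u \<in> S\<close> \<open>r > 0\<close>] by (simp add: null_sets_def)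
  qed
  then show ?thesis using \<open>s > 0\<close> \<open>t > 0\<close> by (simp add: antisym)
qed

section \<open>Strict convexity\<close>

text \<open>
  With \<open>l = b / a\<close> the hypothesis reads \<open>f (l * x) = l * f x + c / a\<close>.  So along \<open>1\<close>, \<open>l\<close>, \<open>l\<^sup>2\<close> both the
  arguments and the values of \<open>f\<close> have increments in the ratio \<open>1 : l\<close>: three points on the graph of \<open>f\<close>
  are collinear, which strict convexity forbids unless \<open>l = 1\<close>.
\<close>

lemma strictly_convex_perspective_injective:
  fixes f :: "real \<Rightarrow> real"
  assumes conv: "strictly_convex_on {0<..} f" and "a > 0" "b > 0"
    and const: "\<And>t. t > 0 \<Longrightarrow> a * f (t / a) - b * f (t / b) = c"
  shows "a = b"
proof (rule ccontr)
  assume "a \<noteq> b"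
  define l where "l = b / a"
  have l: "l > 0" "l \<noteq> 1" using assms(2,3) \<open>a \<noteq> b\<close> by (auto simp: l_def)
  have step: "f (l * x) = l * f x + c / a" if "x > 0" for x
  proof -
    have "a * f (l * x) - b * f x = c"
      using const[of "b * x"] assms(2,3) that by (simp add: l_def mult.commute)
    then show ?thesis using assms(2) by (simp add: l_def field_simps)
  qed
  \<comment> \<open>The weight that writes \<open>l\<close> as a convex combination of \<open>1\<close> and \<open>l\<^sup>2\<close>, for \<open>l < 1\<close> as well as \<open>l > 1\<close>.\<close>
  define \<tau> where "\<tau> = 1 / (1 + l)"
  have \<tau>: "0 < \<tau>" "\<tau> < 1" "(1 + l) * \<tau> = 1" "(1 + l) * (1 - \<tau>) = l"
    using l by (simp_all add: \<tau>_def field_simps)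
  have "(1 + l) * ((1 - \<tau>) *\<^sub>R 1 + \<tau> *\<^sub>R (l * l)) = (1 + l) * (1 - \<tau>) + (1 + l) * \<tau> * (l * l)"
    by (simp add: algebra_simps)
  also have "\<dots> = (1 + l) * l" unfolding \<tau> by (simp add: algebra_simps)
  finally have "(1 - \<tau>) *\<^sub>R 1 + \<tau> *\<^sub>R (l * l) = l"
    using l by simp
  moreover have "l * l \<noteq> 1" using l by (metis abs_of_pos abs_square_eq_1 power2_eq_square)
  moreover have "\<forall>x\<in>{0<..}. \<forall>y\<in>{0<..}. \<forall>t. x \<noteq> y \<and> 0 < t \<and> t < 1 \<longrightarrow>
        f ((1 - t) *\<^sub>R x + t *\<^sub>R y) < (1 - t) * f x + t * f y"
    using conv unfolding strictly_convex_on_def by blast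
  ultimately have "f l < (1 - \<tau>) * f 1 + \<tau> * f (l * l)"
    using l \<tau> by (metis greaterThan_iff mult_pos_pos zero_less_one)
  then have "(1 + l) * f l < (1 + l) * ((1 - \<tau>) * f 1 + \<tau> * f (l * l))"
    using l by simp
  also have "\<dots> = ((1 + l) * (1 - \<tau>)) * f 1 + ((1 + l) * \<tau>) * f (l * l)"
    by (simp add: algebra_simps)
  also have "\<dots> = l * f 1 + f (l * l)" by (simp only: \<tau> mult_1_left)
  also have "\<dots> = (1 + l) * f l"
    using step[of 1] step[of l] l by (simp add: algebra_simps add_divide_distrib)
  finally show False by simp
qed

section \<open>Star bodies and their radial functions\<close>

lemma star_body_ray_mem_iff:
  fixes L :: "'a::real_normed_vector set"
  assumes L: "star_body L" and "norm u = 1" "t > 0"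
  shows "t *\<^sub>R u \<in> L \<longleftrightarrow> t \<le> radial_function L u"
proof -
  define T where "T = {t. t > 0 \<and> t *\<^sub>R u \<in> L}"
  have comp: "compact L" and star: "\<And>x. x \<in> L \<Longrightarrow> closed_segment 0 x \<subseteq> L"
    and "radial_function L u > 0"
    using L assms(2) by (auto simp: star_body_def)
  then have "T \<noteq> {}" and \<rho>: "radial_function L u = Sup T"
    by (auto simp: radial_function_def T_def split: if_splits)
  obtain B where "\<And>x. x \<in> L \<Longrightarrow> norm x \<le> B"
    using compact_imp_bounded[OF comp] by (auto simp: bounded_iff)
  then have "s \<le> B" if "s \<in> T" for s
    using that assms(2) by (force simp: T_def)
  then have bdd: "bdd_above T" by (auto simp: bdd_above_def)
  have below: "s *\<^sub>R u \<in> L" if s: "0 < s" "s < Sup T" for s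
  proof -
    obtain s' where s': "s' \<in> T" "s < s'" using s(2) \<open>T \<noteq> {}\<close> by (rule less_cSupE)
    then have "s *\<^sub>R u \<in> closed_segment 0 (s' *\<^sub>R u)"
      using s by (auto simp: in_segment intro!: exI[of _ "s / s'"])
    then show ?thesis using star s' by (auto simp: T_def)
  qed
  \<comment> \<open>The ray meets \<open>L\<close> in a closed set containing every \<open>s\<close> below the supremum, hence also the supremum.\<close>
  have "closed ((\<lambda>s. s *\<^sub>R u) -` L)"
    using compact_imp_closed[OF comp] by (intro closed_vimage continuous_intros)
  moreover have "{0<..<Sup T} \<subseteq> (\<lambda>s. s *\<^sub>R u) -` L" using below by auto
  ultimately have "closure {0<..<Sup T} \<subseteq> (\<lambda>s. s *\<^sub>R u) -` L" by (rule closure_minimal[rotated])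
  then have "s *\<^sub>R u \<in> L" if "0 < s" "s \<le> Sup T" for s
    using that by (auto dest!: subsetD[of _ _ s])
  moreover have "t \<le> Sup T" if "t *\<^sub>R u \<in> L"
    using that assms(3) bdd by (intro cSup_upper) (auto simp: T_def)
  ultimately show ?thesis using assms(3) by (auto simp: \<rho>)
qed

lemma star_body_eqI:
  fixes K L :: "'a::euclidean_space set"
  assumes K: "star_body K" and L: "star_body L"
    and eq: "\<And>u. norm u = 1 \<Longrightarrow> radial_function K u = radial_function L u"
  shows "K = L"
proof -
  have zero: "0 \<in> M" if M: "star_body M" for M :: "'a set"
  proof -
    obtain u :: 'a where u: "norm u = 1" using nonempty_Basis norm_Basis by blast
    then have "radial_function M u > 0" using M by (auto simp: star_body_def)
    then have "radial_function M u *\<^sub>R u \<in> M" using star_body_ray_mem_iff[OF M u] by simp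
    then have "closed_segment 0 (radial_function M u *\<^sub>R u) \<subseteq> M" using M by (simp add: star_body_def)
    then show ?thesis by auto
  qed
  have "x \<in> K \<longleftrightarrow> x \<in> L" for x
  proof (cases "x = 0")
    case True
    then show ?thesis using zero K L by simp
  next
    case False
    define u where "u = x /\<^sub>R norm x"
    have u: "norm u = 1" "norm x > 0" "x = norm x *\<^sub>R u" using False by (auto simp: u_def)
    show ?thesis
      using star_body_ray_mem_iff[OF K u(1,2)] star_body_ray_mem_iff[OF L u(1,2)] eq[OF u(1)] u(3) by simp
  qed
  then show ?thesis by blast
qed

lemma ex_star_body_radial_function:
  fixes m :: "'a::euclidean_space \<Rightarrow> real"
  assumes m: "continuous_on (sphere 0 1) m" and pos: "\<And>u. norm u = 1 \<Longrightarrow> m u > 0"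
  obtains M where "star_body M" "\<And>u. norm u = 1 \<Longrightarrow> radial_function M u = m u"
proof -
  \<comment> \<open>In this form \<open>M\<close> is a continuous image of a compact set, hence compact.\<close>
  define M where "M = (\<lambda>(t, u). (t * m u) *\<^sub>R u) ` ({0..1} \<times> sphere 0 1)"
  have "continuous_on ({0..1} \<times> sphere 0 1) (\<lambda>p. m (snd p))"
    by (rule continuous_on_compose2[OF m]) (auto intro!: continuous_intros)
  then have "compact M"
    unfolding M_def case_prod_unfold
    by (intro compact_continuous_image continuous_intros compact_Times compact_sphere compact_Icc)
  have star: "closed_segment 0 x \<subseteq> M" if x: "x \<in> M" for x
  proof
    fix y assume "y \<in> closed_segment 0 x"
    then obtain c where c: "0 \<le> c" "c \<le> 1" "y = c *\<^sub>R x" by (auto simp: in_segment)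
    obtain t u where "x = (t * m u) *\<^sub>R u" "0 \<le> t" "t \<le> 1" "norm u = 1"
      using x by (auto simp: M_def)
    with c show "y \<in> M"
      unfolding M_def by (intro image_eqI[of _ _ "(c * t, u)"]) (auto intro: mult_le_one)
  qed
  have ray: "{t. t > 0 \<and> t *\<^sub>R u \<in> M} = {0<..m u}" if u: "norm u = 1" for u
  proof safe
    fix t assume t: "t > 0" "t *\<^sub>R u \<in> M"
    then obtain s v where v: "t *\<^sub>R u = (s * m v) *\<^sub>R v" "0 \<le> s" "s \<le> 1" "norm v = 1"
      by (auto simp: M_def)
    have "norm (t *\<^sub>R u) = t" using t u by simp
    moreover have "norm ((s * m v) *\<^sub>R v) = s * m v" using v pos[of v] by (simp add: abs_mult)
    ultimately have "t = s * m v" using v(1) by metis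
    moreover from this have "u = v" using v(1) t(1) by (metis less_irrefl scaleR_cancel_left)
    ultimately show "t \<in> {0<..m u}" using t v pos[OF u] by (simp add: mult_left_le_one_le)
  next
    fix t assume "t \<in> {0<..m u}"
    then show "t *\<^sub>R u \<in> M" "t > 0"
      unfolding M_def using u pos[OF u] by (auto intro!: image_eqI[of _ _ "(t / m u, u)"])
  qed
  have rad: "radial_function M u = m u" if u: "norm u = 1" for u
  proof -
    have "\<exists>t>0. t *\<^sub>R u \<in> M" using ray[OF u] pos[OF u] by (metis (no_types, lifting) greaterThanAtMost_iff mem_Collect_eq order_refl)
    then show ?thesis using ray[OF u] pos[OF u] by (simp add: radial_function_def)
  qed
  have "continuous_on (sphere 0 1) (radial_function M)"
    using m rad by (subst continuous_on_cong[OF refl, of _ _ m]) auto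
  then have "star_body M"
    unfolding star_body_def using \<open>compact M\<close> star rad pos by auto
  then show ?thesis using that rad by blast
qed

section \<open>Equal dual Orlicz mixed volumes determine the body\<close>

theorem corollary8p3:
  fixes K L Q :: "(real ^ 'n) set"
    and q :: real
    and \<phi> \<phi>q :: "real \<Rightarrow> real"
  assumes "star_body K" and "star_body L" and "star_body Q"
    and "q \<noteq> 0"
    and "continuous_on {0<..} \<phi>" and "\<And>t. t > 0 \<Longrightarrow> \<phi> t > 0"
    and "\<And>t. t > 0 \<Longrightarrow> \<phi>q t = \<phi> (t powr (1 / q))"
    and "strictly_convex_on {0<..} \<phi>q \<or> strictly_concave_on {0<..} \<phi>q"
    and "\<And>M. star_body M \<Longrightarrow>
           dual_orlicz_mixed_volume q \<phi> K M Q = dual_orlicz_mixed_volume q \<phi> L M Q"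
  shows "K = L"
proof (rule star_body_eqI)
  let ?S = "sphere 0 1 :: (real ^ 'n) set"
  let ?\<mu> = "hausdorff_measure (CARD('n) - 1) :: (real ^ 'n) measure"
  define w where "w u = radial_function Q u powr (real CARD('n) - q)" for u
  define I where "I N u t = \<phi> (t / radial_function N u) * radial_function N u powr q * w u"
    for N :: "(real ^ 'n) set" and u t
  have pos: "radial_function N u > 0" if "star_body N" "u \<in> ?S" for N u
    using that by (auto simp: star_body_def)
  have cont: "continuous_on ?S (radial_function N)" if "star_body N" for N :: "(real ^ 'n) set"
    using that by (auto simp: star_body_def)
  have w_pos: "w u > 0" if "u \<in> ?S" for u
    using pos[OF assms(3) that] by (simp add: w_def)
  have w_cont: "continuous_on ?S w"
    unfolding w_def using cont[OF assms(3)] pos[OF assms(3)]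
    by (intro continuous_intros) force+
  have I_cont: "continuous_on (?S \<times> {0<..}) (\<lambda>(u, t). I N u t)" if N: "star_body N" for N
  proof -
    have \<rho>: "continuous_on (?S \<times> {0<..}) (\<lambda>p. radial_function N (fst p) :: real)"
      by (rule continuous_on_compose2[OF cont[OF N]]) (auto intro!: continuous_intros)
    have w: "continuous_on (?S \<times> {0<..}) (\<lambda>p. w (fst p) :: real)"
      by (rule continuous_on_compose2[OF w_cont]) (auto intro!: continuous_intros)
    have "radial_function N (fst p) \<noteq> 0" if "p \<in> ?S \<times> {0<..}" for p
      using pos[OF N, of "fst p"] that by auto
    then have "continuous_on (?S \<times> {0<..}) (\<lambda>p. snd p / radial_function N (fst p))"
      using \<rho> by (intro continuous_on_divide continuous_on_snd continuous_on_id ballI)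
    then have "continuous_on (?S \<times> {0<..}) (\<lambda>p. \<phi> (snd p / radial_function N (fst p)))"
      by (rule continuous_on_compose2[OF assms(5)]) (use pos[OF N] in auto)
    then show ?thesis
      unfolding I_def case_prod_unfold using \<rho> w pos[OF N]
      by (intro continuous_intros) force+
  qed
  have fin: "emeasure ?\<mu> ?S < top"
    using hausdorff_outer_sphere_finite by (subst emeasure_hausdorff_measure) auto
  have zero: "set_lebesgue_integral ?\<mu> ?S (\<lambda>u. I K u (g u) - I L u (g u)) = 0"
    if g: "continuous_on ?S g" "\<And>u. u \<in> ?S \<Longrightarrow> g u > 0" for g
  proof -
    obtain M where M: "star_body M" "\<And>u. norm u = 1 \<Longrightarrow> radial_function M u = g u"
      using g by (auto intro: ex_star_body_radial_function[of g])
    have V: "dual_orlicz_mixed_volume q \<phi> N M Q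
        = 1 / real CARD('n) * set_lebesgue_integral ?\<mu> ?S (\<lambda>u. I N u (g u))" for N
      unfolding dual_orlicz_mixed_volume_def I_def w_def
      by (intro arg_cong2[where f = "(*)"] refl set_lebesgue_integral_cong) (auto simp: M(2))
    have int: "set_integrable ?\<mu> ?S (\<lambda>u. I N u (g u))" if "star_body N" for N
    proof (rule set_integrable_continuous_on_compact[OF _ _ fin])
      show "continuous_on ?S (\<lambda>u. I N u (g u))"
        by (rule continuous_on_along_graph[OF I_cont[OF that]]) (use g in auto)
    qed auto
    show ?thesis
      by (subst set_integral_diff(2)[OF int[OF assms(1)] int[OF assms(2)]])
        (use assms(9)[OF M(1)] in \<open>simp add: V\<close>)
  qed
  fix u :: "real ^ 'n" assume "norm u = 1"
  then have u: "u \<in> ?S" by simp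
  have F_cont: "continuous_on (?S \<times> {0<..}) (\<lambda>(u, t). I K u t - I L u t)"
    using continuous_on_diff[OF I_cont[OF assms(1)] I_cont[OF assms(2)]]
    by (simp add: case_prod_unfold)
  have const: "I K u s - I L u s = I K u t - I L u t" if "s > 0" "t > 0" for s t
  proof (rule constant_if_all_integrals_vanish[where M = ?\<mu> and S = ?S
        and F = "\<lambda>u t. I K u t - I L u t", OF _ _ fin _ F_cont zero u that])
    fix v r assume "v \<in> ?S" "(r :: real) > 0"
    then show "emeasure ?\<mu> (?S \<inter> ball v r) > 0"
      using hausdorff_outer_sphere_ball_pos[of v r] by (subst emeasure_hausdorff_measure) auto
  qed auto
  let ?a = "radial_function K u powr q" and ?b = "radial_function L u powr q"
  have a: "?a > 0" and b: "?b > 0" using pos[OF assms(1) u] pos[OF assms(2) u] by auto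
  \<comment> \<open>The substitution \<open>\<rho>\<^sub>M = t powr (1 / q)\<close> turns the integrand into a perspective of \<open>\<phi>q\<close>.\<close>
  have I_eq: "I N u (t powr (1 / q)) = w u * (radial_function N u powr q * \<phi>q (t / radial_function N u powr q))"
    if "star_body N" "t > 0" for N t
  proof -
    have "(t / radial_function N u powr q) powr (1 / q) = t powr (1 / q) / radial_function N u"
      using pos[OF that(1) u] that(2) assms(4) by (simp add: powr_divide powr_powr)
    then show ?thesis
      using pos[OF that(1) u] that(2) by (subst assms(7)) (auto simp: I_def)
  qed
  define c where "c = (I K u 1 - I L u 1) / w u"
  have eq: "?a * \<phi>q (t / ?a) - ?b * \<phi>q (t / ?b) = c" if "t > 0" for t
  proof -
    have "w u * (?a * \<phi>q (t / ?a) - ?b * \<phi>q (t / ?b)) = I K u 1 - I L u 1"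
      using const[of "t powr (1 / q)" 1] I_eq[OF assms(1) that] I_eq[OF assms(2) that] that
      by (simp add: right_diff_distrib)
    then show ?thesis using w_pos[OF u] by (simp add: c_def field_simps)
  qed
  have "?a = ?b"
    using assms(8)
  proof
    assume "strictly_convex_on {0<..} \<phi>q"
    then show ?thesis using a b eq by (rule strictly_convex_perspective_injective)
  next
    assume "strictly_concave_on {0<..} \<phi>q"
    then have "strictly_convex_on {0<..} (\<lambda>t. - \<phi>q t)" by (simp add: strictly_concave_on_def)
    then show ?thesis using a b
      by (rule strictly_convex_perspective_injective[where c = "- c"]) (use eq in force)
  qed
  then have "?a powr (1 / q) = ?b powr (1 / q)" by simp
  then show "radial_function K u = radial_function L u"
    using assms(4) pos[OF assms(1) u] pos[OF assms(2) u] by (simp add: powr_powr)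
qed (use assms in auto)

end
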